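(* Let $1\le p<\infty$, $1/p+1/q=1$, let $\{\beta(n)\}_{n\ge 0}$ and $\{\delta_n\}_{n\ge0}$ be sequences of positive numbers with $\beta(0)=1$ and $\delta_0=1$, let $m\in\mathbb{N}_0$, let $\varphi(z)=z^m$, let $M(m)=\{km: k\in\mathbb{N}_0\}$, and let $u$ be a formal power series. (a) Suppose $m\ge1$. Put $$\alpha=\sup_{n\in\mathbb{N}_0}\ \sum_{k\in A_{n,m}}\left(\frac{\delta_n\beta(n)}{\delta_k\delta_{n-k}\beta(k)\beta\left(\frac{n-k}{m}\right)}\right)^{q},$$ where $A_{n,m}:=\{k: 0\le k\le n\ \text{and}\ n-k\in M(m)\}$. If $u\in\ell^p(\beta)$ and $\alpha<\infty$, then $u\diamond C_\varphi$ is a bounded operator on $\ell^p(\beta)$, and in this case $\|u\diamond C_\varphi\|\le\alpha^{1/q}\|u\|_\beta$. (b) If $u\diamond C_\varphi$ is a bounded operator on $\ell^p(\beta)$, then $$M:=\sup_{l\in\mathbb{N}_0}\frac{\left(\sum_{n=ml}^{\infty}\left(\frac{\delta_n\beta(n)|\hat u(n-ml)|}{\delta_{ml}\delta_{n-ml}}\right)^p\right)^{1/p}}{\beta(l)}<\infty,$$ and $M\le\|u\diamond C_\varphi\|$.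
   Context: $\mathbb{N}_0=\{0,1,2,\dots\}$. $\ell^{p}(\beta)$ is the space of formal power series $f(z)=\sum_{n\ge 0}\hat f(n)z^{n}$ with complex coefficients such that $\|f\|_\beta^p=\sum_{n\ge 0}|\hat f(n)|^p\beta(n)^p<\infty$, with norm $\|\cdot\|_\beta$. The weighted Cauchy product of formal power series is $(f\diamond g)(z)=\sum_{n\ge0}\sum_{k\ge0}\frac{\delta_{n+k}}{\delta_n\delta_k}\hat f(n)\hat g(k)z^{n+k}$. The $\diamond$-substitution operator is $(u\diamond C_\varphi)(f)=u\diamond(f\circ\varphi)$, where for $\varphi(z)=z^m$, $(f\circ\varphi)(z)=\sum_{n\ge0}\hat f(n)z^{nm}$ (for $m=0$ this is the constant $\sum_n\hat f(n)$, required to converge). It is bounded on $\ell^p(\beta)$ if it is defined on all of $\ell^p(\beta)$, maps it into itself and is bounded for $\|\cdot\|_\beta$; $\|u\diamond C_\varphi\|$ is the operator norm. If $p=1$ then $q=\infty$, and $\alpha^{1/q}$ means $\sup_n\max_{k\in A_{n,m}}\frac{\delta_n\beta(n)}{\delta_k\delta_{n-k}\beta(k)\beta((n-k)/m)}$, with $\alpha<\infty$ meaning this is finite. Standing assumption: if $\lim_n\beta(n+1)/\beta(n)=1$ or $\liminf_n\beta(n)^{1/n}=1$, then $\varphi(\mathbb{D})\subseteq\mathbb{D}$, where $\mathbb{D}$ is the open unit disc of $\mathbb{C}$. *)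

theory Defs
  imports "HOL-Analysis.Analysis" "HOL-Computational_Algebra.Formal_Power_Series"
begin

definition lp_space :: "real \<Rightarrow> (nat \<Rightarrow> real) \<Rightarrow> complex fps set" where
  "lp_space p \<beta> = {f. summable (\<lambda>n. cmod (fps_nth f n) powr p * \<beta> n powr p)}"

text \<open>Meaningful only for elements of \<open>lp_space p \<beta>\<close>.\<close>

definition lp_norm :: "real \<Rightarrow> (nat \<Rightarrow> real) \<Rightarrow> complex fps \<Rightarrow> real" where
  "lp_norm p \<beta> f = (\<Sum>n. cmod (fps_nth f n) powr p * \<beta> n powr p) powr (1 / p)"

text \<open>The double series \<open>\<Sum>n k. \<delta>\<^sub>n\<^sub>+\<^sub>k / (\<delta>\<^sub>n \<delta>\<^sub>k) f\<^sub>n g\<^sub>k z\<^sup>n\<^sup>+\<^sup>k\<close>,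
  collected by powers of \<open>z\<close>.\<close>

definition diamond :: "(nat \<Rightarrow> real) \<Rightarrow> complex fps \<Rightarrow> complex fps \<Rightarrow> complex fps" where
  "diamond \<delta> f g = Abs_fps (\<lambda>N. \<Sum>n\<le>N.
     complex_of_real (\<delta> N / (\<delta> n * \<delta> (N - n))) * fps_nth f n * fps_nth g (N - n))"

text \<open>Composition with \<open>z\<^sup>m\<close>. For \<open>m = 0\<close> it is the constant \<open>\<Sum>n. f\<^sub>n\<close>, where
  \<^const>\<open>fps_compose\<close> (which presupposes a vanishing constant term of the inner series)
  would give the wrong value; it is then defined only if the series converges.\<close>

definition comp_monomial :: "nat \<Rightarrow> complex fps \<Rightarrow> complex fps" where
  "comp_monomial m f =
     (if m = 0 then fps_const (\<Sum>n. fps_nth f n) else fps_compose f (fps_X ^ m))"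

definition comp_monomial_defined :: "nat \<Rightarrow> complex fps \<Rightarrow> bool" where
  "comp_monomial_defined m f \<longleftrightarrow> (m = 0 \<longrightarrow> summable (fps_nth f))"

lemma comp_monomial_nth:
  assumes "m \<ge> 1"
  shows "fps_nth (comp_monomial m f) j = (if m dvd j then fps_nth f (j div m) else 0)"
proof -
  have "fps_nth (comp_monomial m f) j =
      (\<Sum>i=0..j. fps_nth f i * (if j = m * i then 1 else 0))"
    using assms
    by (simp add: comp_monomial_def fps_compose_nth flip: power_mult)
  also have "\<dots> = (\<Sum>i=0..j. if m dvd j \<and> i = j div m then fps_nth f i else 0)"
    using assms by (intro sum.cong) auto
  also have "\<dots> = (if m dvd j then fps_nth f (j div m) else 0)"
    by (cases "m dvd j") (auto simp: sum.delta)
  finally show ?thesis .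
qed

definition diamond_subst ::
  "(nat \<Rightarrow> real) \<Rightarrow> complex fps \<Rightarrow> nat \<Rightarrow> complex fps \<Rightarrow> complex fps" where
  "diamond_subst \<delta> u m f = diamond \<delta> u (comp_monomial m f)"

definition bounded_diamond_subst ::
  "real \<Rightarrow> (nat \<Rightarrow> real) \<Rightarrow> (nat \<Rightarrow> real) \<Rightarrow> complex fps \<Rightarrow> nat \<Rightarrow> bool" where
  "bounded_diamond_subst p \<beta> \<delta> u m \<longleftrightarrow>
     (\<forall>f\<in>lp_space p \<beta>. comp_monomial_defined m f) \<and>
     (\<forall>f\<in>lp_space p \<beta>. diamond_subst \<delta> u m f \<in> lp_space p \<beta>) \<and>
     (\<exists>C. \<forall>f\<in>lp_space p \<beta>. lp_norm p \<beta> (diamond_subst \<delta> u m f) \<le> C * lp_norm p \<beta> f)"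

definition op_norm :: "real \<Rightarrow> (nat \<Rightarrow> real) \<Rightarrow> (complex fps \<Rightarrow> complex fps) \<Rightarrow> ennreal" where
  "op_norm p \<beta> T =
     (SUP f\<in>{f \<in> lp_space p \<beta>. lp_norm p \<beta> f \<le> 1}. ennreal (lp_norm p \<beta> (T f)))"

text \<open>Real powers of extended nonnegative numbers, used for exponents \<open>r > 0\<close> only.\<close>

definition epowr :: "ennreal \<Rightarrow> real \<Rightarrow> ennreal" where
  "epowr x r = (if x = \<infinity> then \<infinity> else ennreal (enn2real x powr r))"

definition A_set :: "nat \<Rightarrow> nat \<Rightarrow> nat set" where
  "A_set n m = {k. k \<le> n \<and> n - k \<in> {j * m |j. True}}"

definition alpha_quot :: "(nat \<Rightarrow> real) \<Rightarrow> (nat \<Rightarrow> real) \<Rightarrow> nat \<Rightarrow> nat \<Rightarrow> nat \<Rightarrow> real" where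
  "alpha_quot \<beta> \<delta> m n k =
     (\<delta> n * \<beta> n) / (\<delta> k * \<delta> (n - k) * \<beta> k * \<beta> ((n - k) div m))"

text \<open>For \<open>q = \<infinity>\<close> the quantities \<open>\<alpha>\<close> and \<open>\<alpha>\<^sup>1\<^sup>/\<^sup>q\<close> are both read as the supremum of the
  maxima of the quotients.\<close>

definition alpha :: "(nat \<Rightarrow> real) \<Rightarrow> (nat \<Rightarrow> real) \<Rightarrow> nat \<Rightarrow> ennreal \<Rightarrow> ennreal" where
  "alpha \<beta> \<delta> m q =
     (if q = \<infinity> then (SUP n. ennreal (Max (alpha_quot \<beta> \<delta> m n ` A_set n m)))
      else (SUP n. ennreal (\<Sum>k\<in>A_set n m. alpha_quot \<beta> \<delta> m n k powr enn2real q)))"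

definition alpha_root :: "(nat \<Rightarrow> real) \<Rightarrow> (nat \<Rightarrow> real) \<Rightarrow> nat \<Rightarrow> ennreal \<Rightarrow> ennreal" where
  "alpha_root \<beta> \<delta> m q =
     (if q = \<infinity> then alpha \<beta> \<delta> m q else epowr (alpha \<beta> \<delta> m q) (1 / enn2real q))"

definition M_sup ::
  "real \<Rightarrow> (nat \<Rightarrow> real) \<Rightarrow> (nat \<Rightarrow> real) \<Rightarrow> complex fps \<Rightarrow> nat \<Rightarrow> ennreal" where
  "M_sup p \<beta> \<delta> u m =
     (SUP l. epowr (\<Sum>\<^sub>\<infinity>n\<in>{m * l..}.
          ennreal ((\<delta> n * \<beta> n * cmod (fps_nth u (n - m * l)) /
                    (\<delta> (m * l) * \<delta> (n - m * l))) powr p)) (1 / p)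
        / ennreal (\<beta> l))"

end

theory Submission
  imports Defs
begin

text \<open>
  Measure the size of the coefficient \<open>f\<^sub>n\<close> by \<open>|f\<^sub>n| \<beta>(n)\<close>, so that the norm of
  \<open>\<ell>\<^sup>p(\<beta>)\<close> becomes an ordinary \<open>\<ell>\<^sup>p\<close> norm.

  For the upper bound, the weighted \<open>N\<close>-th coefficient of \<open>u \<diamond> (f \<circ> z\<^sup>m)\<close> is at most a sum over
  \<open>k \<in> A\<^bsub>N,m\<^esub>\<close> of the quotient in the definition of \<open>\<alpha>\<close> times \<open>x\<^sub>k y\<^bsub>(N-k)/m\<^esub>\<close>, where \<open>x\<close> and \<open>y\<close>
  are the weighted coefficients of \<open>u\<close> and \<open>f\<close>. Hoelder's inequality separates the two factors:
  the quotients contribute at most \<open>\<alpha>\<^sup>1\<^sup>/\<^sup>q\<close>, uniformly in \<open>N\<close> (\<open>weighted_coefficient_bound\<close>), and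
  what remains is the \<open>N\<close>-th term of the Cauchy product of \<open>\<Sum>x\<^sub>k\<^sup>p\<close> with the series
  \<open>\<Sum>y\<^sub>j\<^sup>p\<close> spread out over the multiples of \<open>m\<close>. Summed over \<open>N\<close>, this Cauchy product is exactly
  \<open>\<parallel>u\<parallel>\<^sup>p \<parallel>f\<parallel>\<^sup>p\<close> (\<open>sums_dilated_convolution\<close>).

  For the lower bound, apply the operator to the unit vectors \<open>z\<^sup>l / \<beta>(l)\<close>. Their images are
  shifted and reweighted copies of \<open>u\<close>, whose norms are the quantities in the supremum \<open>M\<close>.
\<close>

section \<open>Hoelder's inequality and dilated convolutions\<close>

text \<open>After both factors are normalised to norm 1, Young's inequality can be summed termwise.\<close>

lemma Hoelder_inequality_sum:
  fixes f g :: "'a \<Rightarrow> real" and p q :: real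
  assumes fin: "finite A" and p: "1 < p" and q: "1 < q" and pq: "1 / p + 1 / q = 1"
    and f: "\<And>i. i \<in> A \<Longrightarrow> 0 \<le> f i" and g: "\<And>i. i \<in> A \<Longrightarrow> 0 \<le> g i"
  shows "(\<Sum>i\<in>A. f i * g i)
           \<le> (\<Sum>i\<in>A. f i powr p) powr (1 / p) * (\<Sum>i\<in>A. g i powr q) powr (1 / q)"
proof -
  define F where "F = (\<Sum>i\<in>A. f i powr p)"
  define G where "G = (\<Sum>i\<in>A. g i powr q)"
  have F0: "0 \<le> F" and G0: "0 \<le> G"
    by (simp_all add: F_def G_def sum_nonneg)
  show ?thesis
  proof (cases "F = 0 \<or> G = 0")
    case True
    then have "f i * g i = 0" if "i \<in> A" for i
      using that fin by (auto simp: F_def G_def sum_nonneg_eq_0_iff)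
    then have "(\<Sum>i\<in>A. f i * g i) = 0" by (intro sum.neutral) blast
    then show ?thesis by simp
  next
    case False
    with F0 G0 have F: "0 < F" and G: "0 < G" by auto
    define s where "s = F powr (1 / p)"
    define t where "t = G powr (1 / q)"
    have s: "0 < s" "s powr p = F" and t: "0 < t" "t powr q = G"
      using F G p q by (simp_all add: s_def t_def powr_powr)
    have "(\<Sum>i\<in>A. (f i / s) * (g i / t)) \<le> (\<Sum>i\<in>A. (f i / s) powr p / p + (g i / t) powr q / q)"
      using s t f g p q pq by (intro sum_mono Youngs_inequality) auto
    also have "\<dots> = (\<Sum>i\<in>A. f i powr p / F / p + g i powr q / G / q)"
      using s t f g by (intro sum.cong) (auto simp: powr_divide)
    also have "\<dots> = 1"
      using F G pq
      by (simp add: sum.distrib F_def [symmetric] G_def [symmetric] flip: sum_divide_distrib)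
    finally have "(\<Sum>i\<in>A. f i * g i) / (s * t) \<le> 1"
      by (simp add: sum_divide_distrib)
    then show ?thesis
      using s t by (simp add: s_def t_def F_def G_def divide_le_eq)
  qed
qed

lemma A_set_eq: "A_set n m = {k. k \<le> n \<and> m dvd n - k}"
  by (auto simp: A_set_def dvd_def mult.commute)

lemma finite_A_set [simp]: "finite (A_set n m)"
  by (simp add: A_set_eq)

text \<open>Extended by zero off the multiples of \<open>m\<close>, the sequence \<open>j \<mapsto> b\<^bsub>j/m\<^esub>\<close> has the same sum as \<open>b\<close>,
  and the sums over \<open>A\<^bsub>N,m\<^esub>\<close> are the terms of its Cauchy product with \<open>a\<close>.\<close>

lemma sums_dilated_convolution:
  fixes a b :: "nat \<Rightarrow> real"
  assumes m: "m \<ge> 1" and a: "summable a" "\<And>n. 0 \<le> a n" and b: "summable b" "\<And>n. 0 \<le> b n"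
  shows "(\<lambda>N. \<Sum>k\<in>A_set N m. a k * b ((N - k) div m)) sums (suminf a * suminf b)"
proof -
  define b' where "b' = (\<lambda>i. if m dvd i then b (i div m) else 0)"
  have mono: "strict_mono ((*) m)"
    using m by (auto simp: strict_mono_def)
  have zero: "b' i = 0" if "i \<notin> range ((*) m)" for i
    using that by (auto simp: b'_def)
  have eq: "(\<lambda>n. b' (m * n)) = b"
    using m by (auto simp: b'_def)
  have b': "summable b'" "suminf b' = suminf b"
    using summable_mono_reindex [of "(*) m" b', OF mono zero]
      suminf_mono_reindex [of "(*) m" b', OF mono zero] b(1) eq by simp_all
  have "(\<lambda>N. \<Sum>k\<le>N. a k * b' (N - k)) sums (suminf a * suminf b')"
    using a b b' by (intro Cauchy_product_sums) (auto simp: b'_def abs_of_nonneg)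
  moreover have "(\<Sum>k\<le>N. a k * b' (N - k)) = (\<Sum>k\<in>A_set N m. a k * b ((N - k) div m))" for N
    by (rule sum.mono_neutral_cong_right) (auto simp: A_set_eq b'_def)
  ultimately show ?thesis
    by (simp add: b'(2))
qed

section \<open>The uniform coefficient estimate\<close>

lemma conjugate_exponent_cases:
  fixes p :: real and q :: ennreal
  assumes p: "1 \<le> p" and pq: "1 / ennreal p + 1 / q = 1"
  obtains "p = 1" "q = \<infinity>"
  | r where "1 < p" "1 < r" "q = ennreal r" "1 / p + 1 / r = 1"
proof (cases q)
  case top
  have "ennreal (1 / p) = ennreal 1"
    using pq top p by (simp add: divide_ennreal flip: ennreal_1)
  then have "p = 1"
    using p by simp
  then show thesis
    using top that(1) by simp
next
  case (real r)
  have r0: "0 < r"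
  proof (rule ccontr)
    assume "\<not> 0 < r"
    with real have "q = 0" by simp
    with pq show False by simp
  qed
  have "ennreal (1 / p + 1 / r) = ennreal 1"
    using pq real p r0 by (simp add: divide_ennreal ennreal_plus flip: ennreal_1)
  then have eq: "1 / p + 1 / r = 1"
    using p r0 by (subst (asm) ennreal_inj) auto
  have "1 / r > 0"
    using r0 by simp
  with eq have "1 / p < 1"
    by linarith
  then have p1: "1 < p"
    using p by (simp add: divide_less_eq)
  have "1 / p > 0"
    using p by simp
  with eq have "1 / r < 1"
    by linarith
  then have "1 < r"
    using r0 by (simp add: divide_less_eq)
  then show thesis
    using that(2) p1 real eq by blast
qed

lemma alpha_root_finite:
  assumes "alpha \<beta> \<delta> m q < \<infinity>"
  shows "alpha_root \<beta> \<delta> m q < \<infinity>"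
  using assms by (auto simp: alpha_root_def epowr_def)

text \<open>For \<open>p > 1\<close> this is Hoelder's inequality with the quotients of \<open>\<alpha>\<close> as one of the factors;
  for \<open>p = 1\<close> each quotient is at most the supremum of the maxima. The constant does not depend
  on \<open>N\<close>, so the estimate can be summed over \<open>N\<close>.\<close>

lemma weighted_coefficient_bound:
  fixes x y :: "nat \<Rightarrow> real"
  assumes p: "1 \<le> p" and pq: "1 / ennreal p + 1 / q = 1"
    and \<beta>: "\<And>n. 0 < \<beta> n" and \<delta>: "\<And>n. 0 < \<delta> n"
    and fin: "alpha \<beta> \<delta> m q < \<infinity>"
    and x: "\<And>n. 0 \<le> x n" and y: "\<And>n. 0 \<le> y n"
  shows "(\<Sum>k\<in>A_set N m. alpha_quot \<beta> \<delta> m N k * (x k * y ((N - k) div m))) powr p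
     \<le> enn2real (alpha_root \<beta> \<delta> m q) powr p
         * (\<Sum>k\<in>A_set N m. x k powr p * y ((N - k) div m) powr p)"
proof -
  have quot: "0 \<le> alpha_quot \<beta> \<delta> m N k" for k
    using \<beta> \<delta> by (simp add: alpha_quot_def less_imp_le)
  let ?K = "enn2real (alpha_root \<beta> \<delta> m q)"
  show ?thesis
    using p pq
  proof (cases rule: conjugate_exponent_cases)
    case 1
    have le: "alpha_quot \<beta> \<delta> m N k \<le> ?K" if "k \<in> A_set N m" for k
    proof -
      have "alpha_quot \<beta> \<delta> m N k \<le> Max (alpha_quot \<beta> \<delta> m N ` A_set N m)"
        using that by (intro Max_ge) auto
      then have "ennreal (alpha_quot \<beta> \<delta> m N k)
          \<le> (SUP n. ennreal (Max (alpha_quot \<beta> \<delta> m n ` A_set n m)))"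
        by (intro SUP_upper2 [of N] ennreal_leI) auto
      then have "ennreal (alpha_quot \<beta> \<delta> m N k) \<le> alpha_root \<beta> \<delta> m q"
        using 1 by (simp add: alpha_root_def alpha_def)
      then have "enn2real (ennreal (alpha_quot \<beta> \<delta> m N k)) \<le> ?K"
        using alpha_root_finite [OF fin] by (intro enn2real_mono) auto
      then show ?thesis
        using quot by simp
    qed
    have "(\<Sum>k\<in>A_set N m. alpha_quot \<beta> \<delta> m N k * (x k * y ((N - k) div m)))
        \<le> (\<Sum>k\<in>A_set N m. ?K * (x k * y ((N - k) div m)))"
      using le x y by (intro sum_mono mult_right_mono) auto
    moreover have "0 \<le> (\<Sum>k\<in>A_set N m. alpha_quot \<beta> \<delta> m N k * (x k * y ((N - k) div m)))"
      using quot x y by (intro sum_nonneg) auto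
    ultimately show ?thesis
      using 1 x y by (simp add: sum_distrib_left)
  next
    case (2 r)
    let ?c = "\<Sum>k\<in>A_set N m. alpha_quot \<beta> \<delta> m N k powr r"
    let ?d = "\<Sum>k\<in>A_set N m. (x k * y ((N - k) div m)) powr p"
    have \<alpha>: "alpha \<beta> \<delta> m q = (SUP n. ennreal (\<Sum>k\<in>A_set n m. alpha_quot \<beta> \<delta> m n k powr r))"
      using 2 by (simp add: alpha_def)
    have K: "?K = enn2real (alpha \<beta> \<delta> m q) powr (1 / r)"
      using 2 fin by (simp add: alpha_root_def epowr_def)
    have "ennreal ?c \<le> alpha \<beta> \<delta> m q"
      unfolding \<alpha> by (rule SUP_upper) simp
    then have "enn2real (ennreal ?c) \<le> enn2real (alpha \<beta> \<delta> m q)"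
      using fin by (intro enn2real_mono) auto
    then have "?c \<le> enn2real (alpha \<beta> \<delta> m q)"
      by (simp add: sum_nonneg)
    then have cK: "?c powr (1 / r) \<le> ?K"
      unfolding K using 2 by (intro powr_mono2) (auto intro: sum_nonneg)
    have "(\<Sum>k\<in>A_set N m. alpha_quot \<beta> \<delta> m N k * (x k * y ((N - k) div m)))
        \<le> ?c powr (1 / r) * ?d powr (1 / p)"
      using 2 quot x y by (intro Hoelder_inequality_sum) auto
    also have "\<dots> \<le> ?K * ?d powr (1 / p)"
      using cK by (intro mult_right_mono) auto
    finally have "(\<Sum>k\<in>A_set N m. alpha_quot \<beta> \<delta> m N k * (x k * y ((N - k) div m))) powr p
        \<le> (?K * ?d powr (1 / p)) powr p"
      using quot x y p by (intro powr_mono2 sum_nonneg mult_nonneg_nonneg) auto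
    also have "\<dots> = ?K powr p * ?d"
      using p by (simp add: powr_mult powr_powr sum_nonneg)
    also have "?d = (\<Sum>k\<in>A_set N m. x k powr p * y ((N - k) div m) powr p)"
      using x y by (intro sum.cong) (auto simp: powr_mult)
    finally show ?thesis .
  qed
qed

section \<open>Boundedness of the substitution operator\<close>

lemma diamond_subst_nth:
  assumes "m \<ge> 1"
  shows "fps_nth (diamond_subst \<delta> u m f) N = (\<Sum>k\<in>A_set N m.
    complex_of_real (\<delta> N / (\<delta> k * \<delta> (N - k))) * fps_nth u k * fps_nth f ((N - k) div m))"
  unfolding diamond_subst_def diamond_def fps_nth_Abs_fps
  by (rule sum.mono_neutral_cong_right)
     (auto simp: A_set_eq comp_monomial_nth [OF assms])

lemma lp_norm_nonneg: "0 \<le> lp_norm p \<beta> f"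
  by (simp add: lp_norm_def)

lemma lp_norm_powr:
  assumes "1 \<le> p" and "f \<in> lp_space p \<beta>"
  shows "lp_norm p \<beta> f powr p = (\<Sum>n. cmod (fps_nth f n) powr p * \<beta> n powr p)"
proof -
  have "0 \<le> (\<Sum>n. cmod (fps_nth f n) powr p * \<beta> n powr p)"
    using assms by (intro suminf_nonneg) (auto simp: lp_space_def)
  then show ?thesis
    using assms by (simp add: lp_norm_def powr_powr)
qed

text \<open>The coefficient estimate, applied to the weighted coefficients of \<open>u\<close> and \<open>f\<close>, bounds the
  series for the norm by a multiple of the dilated convolution of the series for \<open>u\<close> and \<open>f\<close>.\<close>

lemma diamond_subst_bound:
  assumes p: "1 \<le> p" and pq: "1 / ennreal p + 1 / q = 1"
    and \<beta>: "\<And>n. 0 < \<beta> n" and \<delta>: "\<And>n. 0 < \<delta> n"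
    and m: "m \<ge> 1" and fin: "alpha \<beta> \<delta> m q < \<infinity>"
    and u: "u \<in> lp_space p \<beta>" and f: "f \<in> lp_space p \<beta>"
  shows "diamond_subst \<delta> u m f \<in> lp_space p \<beta>"
    and "lp_norm p \<beta> (diamond_subst \<delta> u m f)
           \<le> enn2real (alpha_root \<beta> \<delta> m q) * lp_norm p \<beta> u * lp_norm p \<beta> f"
proof -
  let ?K = "enn2real (alpha_root \<beta> \<delta> m q)"
  let ?T = "diamond_subst \<delta> u m f"
  let ?w = "\<lambda>g n. cmod (fps_nth g n) powr p * \<beta> n powr p"
  let ?c = "\<lambda>N. \<Sum>k\<in>A_set N m. ?w u k * ?w f ((N - k) div m)"
  have conv: "?c sums (suminf (?w u) * suminf (?w f))"
    using u f m by (intro sums_dilated_convolution) (auto simp: lp_space_def)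
  have le: "?w ?T N \<le> ?K powr p * ?c N" for N
  proof -
    let ?x = "\<lambda>k. cmod (fps_nth u k) * \<beta> k" and ?y = "\<lambda>j. cmod (fps_nth f j) * \<beta> j"
    have "cmod (fps_nth ?T N) \<le> (\<Sum>k\<in>A_set N m. \<delta> N / (\<delta> k * \<delta> (N - k))
        * cmod (fps_nth u k) * cmod (fps_nth f ((N - k) div m)))"
      unfolding diamond_subst_nth [OF m]
      using \<delta> by (intro sum_norm_le) (simp add: norm_mult norm_divide abs_of_pos)
    then have "cmod (fps_nth ?T N) * \<beta> N \<le> (\<Sum>k\<in>A_set N m. \<delta> N / (\<delta> k * \<delta> (N - k))
        * cmod (fps_nth u k) * cmod (fps_nth f ((N - k) div m))) * \<beta> N"
      using \<beta> by (intro mult_right_mono) (auto intro: less_imp_le)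
    also have "\<dots> = (\<Sum>k\<in>A_set N m. alpha_quot \<beta> \<delta> m N k * (?x k * ?y ((N - k) div m)))"
      unfolding sum_distrib_right alpha_quot_def
      using \<beta> \<delta> by (intro sum.cong refl) (simp add: field_simps less_imp_neq [symmetric])
    finally have "(cmod (fps_nth ?T N) * \<beta> N) powr p \<le> \<dots> powr p"
      using p \<beta> [of N] by (intro powr_mono2) auto
    also have "\<dots> \<le> ?K powr p * (\<Sum>k\<in>A_set N m. ?x k powr p * ?y ((N - k) div m) powr p)"
      by (intro weighted_coefficient_bound p pq \<beta> \<delta> fin
            mult_nonneg_nonneg norm_ge_zero less_imp_le [OF \<beta>])
    finally show ?thesis
      by (simp add: powr_mult less_imp_le [OF \<beta>])
  qed
  have c: "summable ?c" "suminf ?c = suminf (?w u) * suminf (?w f)"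
    using conv by (simp_all only: sums_iff)
  have sum: "summable (?w ?T)"
  proof (rule summable_comparison_test')
    show "summable (\<lambda>N. ?K powr p * ?c N)"
      by (rule summable_mult [OF c(1)])
    show "norm (?w ?T N) \<le> ?K powr p * ?c N" for N
      using le [of N] by simp
  qed
  then show mem: "?T \<in> lp_space p \<beta>"
    by (simp add: lp_space_def)
  have "suminf (?w ?T) \<le> (\<Sum>N. ?K powr p * ?c N)"
    by (rule suminf_le [OF le sum summable_mult [OF c(1)]])
  also have "\<dots> = ?K powr p * (suminf (?w u) * suminf (?w f))"
    by (simp only: suminf_mult [OF c(1)] c(2))
  also have "\<dots> = (?K * lp_norm p \<beta> u * lp_norm p \<beta> f) powr p"
    using lp_norm_powr [OF p u] lp_norm_powr [OF p f]
    by (simp add: powr_mult lp_norm_nonneg)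
  finally have "lp_norm p \<beta> ?T powr p \<le> (?K * lp_norm p \<beta> u * lp_norm p \<beta> f) powr p"
    using lp_norm_powr [OF p mem] by simp
  then show "lp_norm p \<beta> ?T \<le> ?K * lp_norm p \<beta> u * lp_norm p \<beta> f"
    using p powr_less_mono2 [of p "?K * lp_norm p \<beta> u * lp_norm p \<beta> f" "lp_norm p \<beta> ?T"]
    by (intro leI) (auto simp: lp_norm_nonneg)
qed

lemma bounded_of_alpha_finite:
  assumes p: "1 \<le> p" and pq: "1 / ennreal p + 1 / q = 1"
    and \<beta>: "\<And>n. 0 < \<beta> n" and \<delta>: "\<And>n. 0 < \<delta> n"
    and m: "m \<ge> 1" and fin: "alpha \<beta> \<delta> m q < \<infinity>" and u: "u \<in> lp_space p \<beta>"
  shows "bounded_diamond_subst p \<beta> \<delta> u m"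
    and "op_norm p \<beta> (diamond_subst \<delta> u m)
           \<le> alpha_root \<beta> \<delta> m q * ennreal (lp_norm p \<beta> u)"
proof -
  note bound = diamond_subst_bound [OF p pq \<beta> \<delta> m fin u]
  let ?K = "enn2real (alpha_root \<beta> \<delta> m q)"
  show "bounded_diamond_subst p \<beta> \<delta> u m"
    unfolding bounded_diamond_subst_def comp_monomial_defined_def
    using bound m by auto
  have "ennreal (lp_norm p \<beta> (diamond_subst \<delta> u m f))
      \<le> alpha_root \<beta> \<delta> m q * ennreal (lp_norm p \<beta> u)"
    if f: "f \<in> lp_space p \<beta>" and f1: "lp_norm p \<beta> f \<le> 1" for f
  proof -
    have "lp_norm p \<beta> (diamond_subst \<delta> u m f) \<le> ?K * lp_norm p \<beta> u * lp_norm p \<beta> f"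
      by (rule bound [OF f])
    also have "\<dots> \<le> ?K * lp_norm p \<beta> u"
      using f1 by (intro mult_left_le) (auto simp: lp_norm_nonneg)
    finally have "ennreal (lp_norm p \<beta> (diamond_subst \<delta> u m f)) \<le> ennreal (?K * lp_norm p \<beta> u)"
      by (rule ennreal_leI)
    also have "\<dots> = alpha_root \<beta> \<delta> m q * ennreal (lp_norm p \<beta> u)"
      using alpha_root_finite [OF fin] by (simp add: ennreal_mult lp_norm_nonneg)
    finally show ?thesis .
  qed
  then show "op_norm p \<beta> (diamond_subst \<delta> u m) \<le> alpha_root \<beta> \<delta> m q * ennreal (lp_norm p \<beta> u)"
    unfolding op_norm_def by (intro SUP_least) auto
qed

section \<open>The lower bound from monomials\<close>

lemma infsum_ennreal_sums:
  fixes h :: "nat \<Rightarrow> real"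
  assumes nonneg: "\<And>n. n \<in> A \<Longrightarrow> 0 \<le> h n" and sums: "(\<lambda>n. if n \<in> A then h n else 0) sums S"
  shows "(\<Sum>\<^sub>\<infinity>n\<in>A. ennreal (h n)) = ennreal S"
proof -
  have "((\<lambda>n. if n \<in> A then h n else 0) has_sum S) UNIV"
    using sums nonneg by (intro sums_nonneg_imp_has_sum) auto
  moreover have "((\<lambda>n. if n \<in> A then h n else 0) has_sum S) UNIV \<longleftrightarrow> (h has_sum S) A"
    by (rule has_sum_cong_neutral) auto
  ultimately have "(h has_sum S) A"
    by simp
  then have "((\<lambda>F. ennreal (sum h F)) \<longlongrightarrow> ennreal S) (finite_subsets_at_top A)"
    unfolding has_sum_def by (rule tendsto_ennrealI)
  moreover have "\<forall>\<^sub>F F in finite_subsets_at_top A. ennreal (sum h F) = (\<Sum>n\<in>F. ennreal (h n))"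
    using nonneg
    by (intro eventually_finite_subsets_at_top_weakI sum_ennreal [symmetric]) auto
  ultimately have "((\<lambda>n. ennreal (h n)) has_sum ennreal S) A"
    unfolding has_sum_def by (rule Lim_transform_eventually)
  then show ?thesis
    by (rule infsumI)
qed

text \<open>The convention for \<open>m = 0\<close> fits the general pattern here: \<open>c z\<^sup>l\<close> is sent to the constant \<open>c\<close>,
  which is \<open>c z\<^sup>m\<^sup>l\<close>. The lower bound therefore needs no case distinction on \<open>m\<close>.\<close>

lemma comp_monomial_monomial_nth:
  "fps_nth (comp_monomial m (fps_const c * fps_X ^ l)) j = (if j = m * l then c else 0)"
proof (cases "m = 0")
  case True
  have "fps_nth (fps_const c * fps_X ^ l) = (\<lambda>n. if n = l then c else 0)"
    by (auto simp: fps_X_power_nth)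
  then have "suminf (fps_nth (fps_const c * fps_X ^ l)) = c"
    using sums_unique [OF sums_single [of l "\<lambda>_. c"]] by simp
  then show ?thesis
    using True by (simp add: comp_monomial_def)
next
  case False
  then show ?thesis
    by (auto simp: comp_monomial_nth fps_X_power_nth)
qed

lemma diamond_subst_monomial_nth:
  "fps_nth (diamond_subst \<delta> u m (fps_const c * fps_X ^ l)) N =
     (if m * l \<le> N
      then complex_of_real (\<delta> N / (\<delta> (m * l) * \<delta> (N - m * l))) * fps_nth u (N - m * l) * c
      else 0)"
proof -
  let ?g = "\<lambda>n. complex_of_real (\<delta> N / (\<delta> n * \<delta> (N - n))) * fps_nth u n"
  have "fps_nth (diamond_subst \<delta> u m (fps_const c * fps_X ^ l)) N
      = (\<Sum>n\<le>N. ?g n * (if N - n = m * l then c else 0))"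
    by (simp add: diamond_subst_def diamond_def comp_monomial_monomial_nth)
  also have "\<dots> = (\<Sum>n\<le>N. if m * l \<le> N \<and> n = N - m * l then ?g (N - m * l) * c else 0)"
    by (intro sum.cong) auto
  also have "\<dots> = (if m * l \<le> N then ?g (N - m * l) * c else 0)"
    by (cases "m * l \<le> N") auto
  finally show ?thesis
    by (simp add: mult.commute)
qed

lemma normalised_monomial:
  assumes \<beta>: "0 < \<beta> l"
  shows "fps_const (complex_of_real (1 / \<beta> l)) * fps_X ^ l \<in> lp_space p \<beta>"
    and "lp_norm p \<beta> (fps_const (complex_of_real (1 / \<beta> l)) * fps_X ^ l) = 1"
proof -
  let ?e = "fps_const (complex_of_real (1 / \<beta> l)) * fps_X ^ l"
  have "(\<lambda>n. cmod (fps_nth ?e n) powr p * \<beta> n powr p) = (\<lambda>n. if n = l then 1 else 0)"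
    using \<beta> by (auto simp: fps_X_power_nth norm_divide powr_divide)
  then have "(\<lambda>n. cmod (fps_nth ?e n) powr p * \<beta> n powr p) sums 1"
    using sums_single [of l "\<lambda>_. 1 :: real"] by simp
  then show "?e \<in> lp_space p \<beta>" and "lp_norm p \<beta> ?e = 1"
    by (auto simp: lp_space_def lp_norm_def sums_iff)
qed

text \<open>By the coefficient formula, the two series agree term by term up to the factor \<open>\<beta>(l)\<^sup>p\<close>;
  since the image lies in \<open>\<ell>\<^sup>p(\<beta>)\<close>, the extended nonnegative sum is finite and is the real one.\<close>

lemma lp_norm_diamond_subst_monomial:
  assumes p: "1 \<le> p" and \<beta>: "\<And>n. 0 < \<beta> n" and \<delta>: "\<And>n. 0 < \<delta> n"
    and mem: "diamond_subst \<delta> u m (fps_const (complex_of_real (1 / \<beta> l)) * fps_X ^ l)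
                \<in> lp_space p \<beta>"
  shows "epowr (\<Sum>\<^sub>\<infinity>n\<in>{m * l..}.
          ennreal ((\<delta> n * \<beta> n * cmod (fps_nth u (n - m * l)) /
                    (\<delta> (m * l) * \<delta> (n - m * l))) powr p)) (1 / p) / ennreal (\<beta> l)
       = ennreal (lp_norm p \<beta>
           (diamond_subst \<delta> u m (fps_const (complex_of_real (1 / \<beta> l)) * fps_X ^ l)))"
proof -
  let ?T = "diamond_subst \<delta> u m (fps_const (complex_of_real (1 / \<beta> l)) * fps_X ^ l)"
  let ?h = "\<lambda>n. (\<delta> n * \<beta> n * cmod (fps_nth u (n - m * l)) /
                    (\<delta> (m * l) * \<delta> (n - m * l))) powr p"
  let ?S = "lp_norm p \<beta> ?T powr p"
  have "cmod (fps_nth ?T n) powr p * \<beta> n powr p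
      = (if n \<in> {m * l..} then ?h n else 0) / \<beta> l powr p" for n
    unfolding diamond_subst_monomial_nth
    using p \<beta> [of n] \<beta> [of l] \<delta> [of n] \<delta> [of "m * l"] \<delta> [of "n - m * l"]
    by (simp add: norm_mult norm_divide abs_of_pos powr_mult powr_divide field_simps)
  moreover have "(\<lambda>n. cmod (fps_nth ?T n) powr p * \<beta> n powr p) sums ?S"
    using mem lp_norm_powr [OF p mem] by (simp add: lp_space_def sums_iff)
  ultimately have "(\<lambda>n. (if n \<in> {m * l..} then ?h n else 0) / \<beta> l powr p) sums ?S"
    by simp
  then have "(\<lambda>n. (if n \<in> {m * l..} then ?h n else 0) / \<beta> l powr p * \<beta> l powr p)
      sums (?S * \<beta> l powr p)"
    by (rule sums_mult2)
  then have "(\<lambda>n. if n \<in> {m * l..} then ?h n else 0) sums (?S * \<beta> l powr p)"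
    using \<beta> [of l] by simp
  then have "(\<Sum>\<^sub>\<infinity>n\<in>{m * l..}. ennreal (?h n)) = ennreal (?S * \<beta> l powr p)"
    by (intro infsum_ennreal_sums) auto
  also have "epowr \<dots> (1 / p) = ennreal (lp_norm p \<beta> ?T * \<beta> l)"
    using p \<beta> [of l] by (simp add: epowr_def powr_mult powr_powr lp_norm_nonneg)
  also have "\<dots> / ennreal (\<beta> l) = ennreal (lp_norm p \<beta> ?T)"
    using \<beta> [of l] by (simp add: divide_ennreal lp_norm_nonneg)
  finally show ?thesis .
qed

lemma op_norm_finite:
  assumes "bounded_diamond_subst p \<beta> \<delta> u m"
  shows "op_norm p \<beta> (diamond_subst \<delta> u m) < \<infinity>"
proof -
  obtain C where C: "\<And>f. f \<in> lp_space p \<beta> \<Longrightarrow>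
      lp_norm p \<beta> (diamond_subst \<delta> u m f) \<le> C * lp_norm p \<beta> f"
    using assms by (auto simp: bounded_diamond_subst_def)
  \<comment> \<open>The sign of \<open>C\<close> is unknown, and for negative \<open>C\<close> the product with the norm of \<open>f\<close> exceeds \<open>C\<close>
    when that norm is below 1.\<close>
  have "lp_norm p \<beta> (diamond_subst \<delta> u m f) \<le> \<bar>C\<bar>"
    if "f \<in> lp_space p \<beta>" "lp_norm p \<beta> f \<le> 1" for f
  proof -
    have "C * lp_norm p \<beta> f \<le> \<bar>C\<bar> * lp_norm p \<beta> f"
      by (intro mult_right_mono) (auto simp: lp_norm_nonneg)
    also have "\<dots> \<le> \<bar>C\<bar>"
      using that by (intro mult_left_le) auto
    finally show ?thesis
      using C [OF that(1)] by linarith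
  qed
  then have "op_norm p \<beta> (diamond_subst \<delta> u m) \<le> ennreal \<bar>C\<bar>"
    unfolding op_norm_def by (intro SUP_least ennreal_leI) auto
  then show ?thesis
    using ennreal_less_top le_less_trans by (metis infinity_ennreal_def)
qed

lemma M_sup_le_op_norm:
  assumes p: "1 \<le> p" and \<beta>: "\<And>n. 0 < \<beta> n" and \<delta>: "\<And>n. 0 < \<delta> n"
    and bounded: "bounded_diamond_subst p \<beta> \<delta> u m"
  shows "M_sup p \<beta> \<delta> u m \<le> op_norm p \<beta> (diamond_subst \<delta> u m)"
  unfolding M_sup_def
proof (rule SUP_least)
  fix l
  let ?e = "fps_const (complex_of_real (1 / \<beta> l)) * fps_X ^ l"
  note e = normalised_monomial [of \<beta> l p, OF \<beta>]
  have "diamond_subst \<delta> u m ?e \<in> lp_space p \<beta>"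
    using bounded e(1) by (auto simp: bounded_diamond_subst_def)
  then have "epowr (\<Sum>\<^sub>\<infinity>n\<in>{m * l..}.
          ennreal ((\<delta> n * \<beta> n * cmod (fps_nth u (n - m * l)) /
                    (\<delta> (m * l) * \<delta> (n - m * l))) powr p)) (1 / p) / ennreal (\<beta> l)
      = ennreal (lp_norm p \<beta> (diamond_subst \<delta> u m ?e))"
    by (rule lp_norm_diamond_subst_monomial [OF p \<beta> \<delta>])
  also have "\<dots> \<le> op_norm p \<beta> (diamond_subst \<delta> u m)"
    unfolding op_norm_def using e by (intro SUP_upper) simp
  finally show "epowr (\<Sum>\<^sub>\<infinity>n\<in>{m * l..}.
          ennreal ((\<delta> n * \<beta> n * cmod (fps_nth u (n - m * l)) /
                    (\<delta> (m * l) * \<delta> (n - m * l))) powr p)) (1 / p) / ennreal (\<beta> l)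
      \<le> op_norm p \<beta> (diamond_subst \<delta> u m)" .
qed

theorem theorem2p3:
  fixes p :: real and q :: ennreal
    and \<beta> \<delta> :: "nat \<Rightarrow> real"
    and m :: nat and u :: "complex fps"
  assumes p: "1 \<le> p" and pq: "1 / ennreal p + 1 / q = 1"
    and \<beta>_pos: "\<And>n. 0 < \<beta> n" and \<delta>_pos: "\<And>n. 0 < \<delta> n"
    and \<beta>0: "\<beta> 0 = 1" and \<delta>0: "\<delta> 0 = 1"
    and standing: "(\<lambda>n. \<beta> (Suc n) / \<beta> n) \<longlonglongrightarrow> 1
        \<or> liminf (\<lambda>n. ereal (root n (\<beta> n))) = 1
      \<Longrightarrow> (\<lambda>z::complex. z ^ m) ` ball 0 1 \<subseteq> ball 0 1"
  shows "(m \<ge> 1 \<and> u \<in> lp_space p \<beta> \<and> alpha \<beta> \<delta> m q < \<infinity> \<longrightarrow>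
            bounded_diamond_subst p \<beta> \<delta> u m \<and>
            op_norm p \<beta> (diamond_subst \<delta> u m)
              \<le> alpha_root \<beta> \<delta> m q * ennreal (lp_norm p \<beta> u))
       \<and> (bounded_diamond_subst p \<beta> \<delta> u m \<longrightarrow>
            M_sup p \<beta> \<delta> u m < \<infinity> \<and>
            M_sup p \<beta> \<delta> u m \<le> op_norm p \<beta> (diamond_subst \<delta> u m))"
proof (intro conjI impI)
  assume a: "m \<ge> 1 \<and> u \<in> lp_space p \<beta> \<and> alpha \<beta> \<delta> m q < \<infinity>"
  show "bounded_diamond_subst p \<beta> \<delta> u m"
    using a by (intro bounded_of_alpha_finite(1) [OF p pq \<beta>_pos \<delta>_pos]) auto
  show "op_norm p \<beta> (diamond_subst \<delta> u m) \<le> alpha_root \<beta> \<delta> m q * ennreal (lp_norm p \<beta> u)"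
    using a by (intro bounded_of_alpha_finite(2) [OF p pq \<beta>_pos \<delta>_pos]) auto
next
  assume b: "bounded_diamond_subst p \<beta> \<delta> u m"
  show le: "M_sup p \<beta> \<delta> u m \<le> op_norm p \<beta> (diamond_subst \<delta> u m)"
    by (rule M_sup_le_op_norm [OF p \<beta>_pos \<delta>_pos b])
  show "M_sup p \<beta> \<delta> u m < \<infinity>"
    using le op_norm_finite [OF b] by (rule le_less_trans)
qed

end
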